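(* If a manifold $M$ carries a minimal flow, then $M$ is metrizable.
   Context: A manifold is a connected Hausdorff topological manifold (locally homeomorphic to some $\mathbb{R}^n$), not assumed metrizable a priori. A flow on a space $X$ is a continuous action $f\colon\mathbb{R}\times X\to X$ of the additive group $\mathbb{R}$. A flow is minimal if every orbit $f(\mathbb{R}\times\{x\})$ is dense in $X$. *)

theory Defs
  imports "HOL-Analysis.Analysis"
begin

definition locally_Euclidean :: "nat \<Rightarrow> 'a topology \<Rightarrow> bool" where
  "locally_Euclidean n X \<longleftrightarrow>
     (\<forall>x\<in>topspace X. \<exists>U V. openin X U \<and> x \<in> U \<and> openin (Euclidean_space n) V \<and>
        subtopology X U homeomorphic_space subtopology (Euclidean_space n) V)"

(* No second countability, paracompactness or metrizability is required. *)
definition manifold :: "'a topology \<Rightarrow> bool" where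
  "manifold X \<longleftrightarrow>
     connected_space X \<and> Hausdorff_space X \<and> (\<exists>n. locally_Euclidean n X)"

definition flow_on :: "'a topology \<Rightarrow> (real \<times> 'a \<Rightarrow> 'a) \<Rightarrow> bool" where
  "flow_on X f \<longleftrightarrow>
     continuous_map (prod_topology euclideanreal X) X f \<and>
     (\<forall>x\<in>topspace X. f (0, x) = x) \<and>
     (\<forall>s t. \<forall>x\<in>topspace X. f (s + t, x) = f (s, f (t, x)))"

definition minimal_flow_on :: "'a topology \<Rightarrow> (real \<times> 'a \<Rightarrow> 'a) \<Rightarrow> bool" where
  "minimal_flow_on X f \<longleftrightarrow>
     flow_on X f \<and>
     (\<forall>x\<in>topspace X. X closure_of (f ` (UNIV \<times> {x})) = topspace X)"

end

theory Submission
  imports Defs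
begin

text \<open>By minimality every orbit enters a fixed chart domain \<open>U\<close>, and by continuity it does so at a
  rational time. Hence \<open>M\<close> is covered by the countably many preimages of \<open>U\<close> under the time-\<open>q\<close>
  homeomorphisms, \<open>q\<close> rational. Each of them is open and second countable, so \<open>M\<close> is second
  countable. As a locally compact Hausdorff space \<open>M\<close> is also regular, and Urysohn's metrization
  theorem applies.\<close>

section \<open>Urysohn's metrization theorem\<close>

text \<open>The evaluation map is injective because some \<open>f i\<close> separates any two given
  points. It is open onto its image because the points with \<open>f i < 1\<close> all lie in the
  prescribed open set.\<close>

lemma embedding_map_separating_family:
  fixes f :: "'i \<Rightarrow> 'a \<Rightarrow> real"
  assumes "t1_space X"
    and cont: "\<And>i. i \<in> I \<Longrightarrow> continuous_map X euclideanreal (f i)"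
    and sep: "\<And>U x. openin X U \<Longrightarrow> x \<in> U \<Longrightarrow>
                \<exists>i\<in>I. f i x = 0 \<and> (\<forall>y \<in> topspace X - U. f i y = 1)"
  shows "embedding_map X (product_topology (\<lambda>i. euclideanreal) I) (\<lambda>x. \<lambda>i\<in>I. f i x)"
proof -
  define Y where "Y = product_topology (\<lambda>i::'i. euclideanreal) I"
  define e where "e = (\<lambda>x. \<lambda>i\<in>I. f i x)"
  have conte: "continuous_map X Y e"
    unfolding Y_def e_def continuous_map_componentwise using cont by auto
  have inj: "inj_on e (topspace X)"
  proof (rule inj_onI, rule ccontr)
    fix x y
    assume xy: "x \<in> topspace X" "y \<in> topspace X" "e x = e y" "x \<noteq> y"
    then obtain U where "openin X U" "x \<in> U" "y \<notin> U"
      using \<open>t1_space X\<close> unfolding t1_space_def by meson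
    with sep xy obtain i where "i \<in> I" "f i x = 0" "f i y = 1"
      by blast
    then have "e x i \<noteq> e y i"
      by (simp add: e_def)
    with xy show False by simp
  qed
  have "openin (subtopology Y (e ` topspace X)) (e ` U)" if U: "openin X U" for U
  proof (subst openin_subopen, intro ballI)
    fix z
    assume "z \<in> e ` U"
    then obtain x where x: "x \<in> U" "z = e x" by auto
    obtain i where i: "i \<in> I" "f i x = 0" "\<forall>y \<in> topspace X - U. f i y = 1"
      using sep[OF U x(1)] by blast
    \<comment> \<open>A cylinder over coordinate \<open>i\<close>: it contains \<open>z\<close>,
      whose coordinate there is 0, while \<open>e y\<close> with \<open>y\<close> outside
      \<open>U\<close> has coordinate 1 and is excluded.\<close>
    define W where "W = {w \<in> topspace Y. w i \<in> {..<1}}"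
    have "openin Y W"
      unfolding W_def Y_def
      using i(1) by (intro openin_continuous_map_preimage[OF continuous_map_product_projection]) auto
    moreover have "z \<in> W \<inter> e ` topspace X"
      using x i U conte openin_subset[OF U]
      by (auto simp: W_def e_def continuous_map_def)
    moreover have "W \<inter> e ` topspace X \<subseteq> e ` U"
      using i by (force simp: W_def e_def)
    ultimately show "\<exists>T. openin (subtopology Y (e ` topspace X)) T \<and> z \<in> T \<and> T \<subseteq> e ` U"
      by (meson openin_subtopology_Int)
  qed
  moreover have "e ` topspace X \<subseteq> topspace Y"
    using conte by (simp add: continuous_map_image_subset_topspace)
  ultimately have "homeomorphic_map X (subtopology Y (e ` topspace X)) e"
    using conte inj
    by (intro bijective_open_imp_homeomorphic_map)
       (auto simp: open_map_def continuous_map_in_subtopology)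
  then show ?thesis
    by (simp add: embedding_map_def Y_def e_def)
qed

text \<open>A countable base yields countably many Urysohn functions that separate points from
  closed sets, so \<open>X\<close> embeds into a countable product of real lines.\<close>

theorem Urysohn_metrization:
  assumes "regular_space X" "Hausdorff_space X" "second_countable X"
  shows "metrizable_space X"
proof -
  obtain \<B> where "countable \<B>" and opB: "\<And>V. V \<in> \<B> \<Longrightarrow> openin X V"
    and base: "\<And>U x. openin X U \<Longrightarrow> x \<in> U \<Longrightarrow> \<exists>V\<in>\<B>. x \<in> V \<and> V \<subseteq> U"
    using \<open>second_countable X\<close> by (auto simp: second_countable_def)
  have "normal_space X"
    using assms by (simp add: regular_Lindelof_imp_normal_space second_countable_imp_Lindelof_space)
  \<comment> \<open>For such a pair, the closure of \<open>A\<close> and the complement of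
    \<open>B\<close> are disjoint closed sets, as Urysohn's lemma requires.\<close>
  define I where "I = {(A, B). A \<in> \<B> \<and> B \<in> \<B> \<and> X closure_of A \<subseteq> B}"
  have "countable I"
    by (rule countable_subset[of _ "\<B> \<times> \<B>"]) (use \<open>countable \<B>\<close> in \<open>auto simp: I_def\<close>)
  have "\<exists>f. continuous_map X euclideanreal f \<and> f ` (X closure_of fst p) \<subseteq> {0} \<and>
            f ` (topspace X - snd p) \<subseteq> {1}" if "p \<in> I" for p
  proof -
    have "closedin X (topspace X - snd p)" "disjnt (X closure_of fst p) (topspace X - snd p)"
      using that opB by (auto simp: I_def disjnt_iff)
    then show ?thesis
      using \<open>normal_space X\<close> unfolding normal_space_iff_Urysohn_alt by simp
  qed
  then obtain f where f: "\<And>p. p \<in> I \<Longrightarrow> continuous_map X euclideanreal (f p) \<and>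
      f p ` (X closure_of fst p) \<subseteq> {0} \<and> f p ` (topspace X - snd p) \<subseteq> {1}"
    by metis
  have "embedding_map X (product_topology (\<lambda>i. euclideanreal) I) (\<lambda>x. \<lambda>p\<in>I. f p x)"
  proof (rule embedding_map_separating_family)
    show "t1_space X"
      using \<open>Hausdorff_space X\<close> by (rule Hausdorff_imp_t1_space)
    show "continuous_map X euclideanreal (f p)" if "p \<in> I" for p
      using f that by blast
    fix U x
    assume U: "openin X U" "x \<in> U"
    then obtain B where B: "B \<in> \<B>" "x \<in> B" "B \<subseteq> U"
      using base by blast
    \<comment> \<open>The closed set \<open>C\<close> traps the closure of any basic set inside
      \<open>W\<close>, so that \<open>(A, B)\<close> becomes an admissible index.\<close>
    obtain W C where WC: "openin X W" "closedin X C" "x \<in> W" "W \<subseteq> C" "C \<subseteq> B"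
      using \<open>regular_space X\<close> opB B unfolding neighbourhood_base_of_closedin [symmetric] neighbourhood_base_of
      by meson
    then obtain A where A: "A \<in> \<B>" "x \<in> A" "A \<subseteq> W"
      using base by blast
    have p: "(A, B) \<in> I"
      using A B WC closure_of_minimal[OF order_trans[OF A(3) WC(4)] WC(2)] by (auto simp: I_def)
    have "x \<in> X closure_of A"
      using A opB by (meson closure_of_subset openin_subset subsetD)
    then show "\<exists>p\<in>I. f p x = 0 \<and> (\<forall>y \<in> topspace X - U. f p y = 1)"
      using f[OF p] B p by (intro bexI[of _ "(A, B)"]) auto
  qed
  then have "X homeomorphic_space
      subtopology (product_topology (\<lambda>i. euclideanreal) I) ((\<lambda>x. \<lambda>p\<in>I. f p x) ` topspace X)"
    by (rule embedding_map_imp_homeomorphic_space)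
  \<comment> \<open>Countability of \<open>I\<close> enters here: it leaves only countably many
    nondegenerate factors.\<close>
  moreover have "metrizable_space (product_topology (\<lambda>i. euclideanreal) I)"
    unfolding metrizable_space_product_topology
    using countable_subset[OF _ \<open>countable I\<close>] by (simp add: metrizable_space_euclidean)
  ultimately show ?thesis
    using homeomorphic_metrizable_space metrizable_space_subtopology by blast
qed

section \<open>Countability and local compactness of locally Euclidean spaces\<close>

text \<open>The countable bases of the pieces unite to a base of \<open>X\<close>, since a set open
  in an open piece is open in \<open>X\<close>.\<close>

lemma second_countable_countable_open_cover:
  assumes "countable \<U>" "\<And>U. U \<in> \<U> \<Longrightarrow> openin X U"
    and "\<And>U. U \<in> \<U> \<Longrightarrow> second_countable (subtopology X U)"
    and "topspace X \<subseteq> \<Union>\<U>"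
  shows "second_countable X"
proof -
  have "\<forall>U\<in>\<U>. \<exists>\<B>. countable \<B> \<and> (\<forall>V \<in> \<B>. openin (subtopology X U) V) \<and>
      (\<forall>W x. openin (subtopology X U) W \<and> x \<in> W \<longrightarrow> (\<exists>V \<in> \<B>. x \<in> V \<and> V \<subseteq> W))"
    using assms(3) by (simp add: second_countable_def)
  then obtain \<B> where \<B>: "\<And>U. U \<in> \<U> \<Longrightarrow> countable (\<B> U)"
      "\<And>U V. U \<in> \<U> \<Longrightarrow> V \<in> \<B> U \<Longrightarrow> openin (subtopology X U) V"
      "\<And>U W x. \<lbrakk>U \<in> \<U>; openin (subtopology X U) W; x \<in> W\<rbrakk> \<Longrightarrow> \<exists>V \<in> \<B> U. x \<in> V \<and> V \<subseteq> W"
    by metis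
  show ?thesis
    unfolding second_countable_def
  proof (intro exI conjI ballI allI impI)
    show "countable (\<Union>U\<in>\<U>. \<B> U)"
      using assms(1) \<B>(1) by blast
    show "openin X V" if "V \<in> (\<Union>U\<in>\<U>. \<B> U)" for V
      using that \<B>(2) assms(2) by (auto dest: openin_trans_full)
    fix W x
    assume W: "openin X W \<and> x \<in> W"
    then obtain U where U: "U \<in> \<U>" "x \<in> U"
      using assms(4) openin_subset by blast
    \<comment> \<open>The base \<open>\<B> U\<close> only handles sets open in the piece, so
      \<open>W\<close> is first cut down to \<open>U\<close>.\<close>
    have "openin (subtopology X U) (U \<inter> W)"
      using W by (simp add: openin_subtopology_Int2)
    then show "\<exists>V\<in>\<Union>U\<in>\<U>. \<B> U. x \<in> V \<and> V \<subseteq> W"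
      using \<B>(3)[OF U(1), of "U \<inter> W" x] U W by blast
  qed
qed

lemma second_countable_euclidean:
  "second_countable (euclidean :: 'a::second_countable_topology topology)"
proof -
  obtain \<B> :: "'a set set" where \<B>: "countable \<B>" "topological_basis \<B>"
    using ex_countable_basis by blast
  have "\<exists>V\<in>\<B>. x \<in> V \<and> V \<subseteq> U" if "open U" "x \<in> U" for U x
    using topological_basisE[OF \<B>(2) that] by metis
  moreover have "open V" if "V \<in> \<B>" for V
    using topological_basis_open[OF \<B>(2) that] .
  ultimately show ?thesis
    unfolding second_countable_def using \<B>(1) by (intro exI[of _ \<B>]) simp
qed

text \<open>\<open>Euclidean_space n\<close> is a subspace of the product of countably many real
  lines, which is the type-class topology on real sequences.\<close>

lemma second_countable_Euclidean_space: "second_countable (Euclidean_space n)"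
  unfolding Euclidean_space_def euclidean_product_topology
  by (intro second_countable_subtopology second_countable_euclidean)

text \<open>A compact neighbourhood found inside a chart domain stays one in \<open>X\<close>,
  because the domain is open and compactness does not depend on the ambient space.\<close>

lemma locally_Euclidean_imp_locally_compact_space:
  assumes "locally_Euclidean n X"
  shows "locally_compact_space X"
  unfolding locally_compact_space_def
proof
  fix x
  assume "x \<in> topspace X"
  then obtain U V where U: "openin X U" "x \<in> U" and V: "openin (Euclidean_space n) V"
    and hom: "subtopology X U homeomorphic_space subtopology (Euclidean_space n) V"
    using assms unfolding locally_Euclidean_def by meson
  have "locally_compact_space (subtopology (Euclidean_space n) V)"
    using V by (simp add: locally_compact_space_open_subset locally_compact_Euclidean_space
                          Hausdorff_Euclidean_space)
  then have "locally_compact_space (subtopology X U)"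
    using hom homeomorphic_locally_compact_space by blast
  then obtain W K where "openin (subtopology X U) W" "compactin (subtopology X U) K" "x \<in> W" "W \<subseteq> K"
    using U \<open>x \<in> topspace X\<close> unfolding locally_compact_space_def topspace_subtopology by blast
  then show "\<exists>U K. openin X U \<and> compactin X K \<and> x \<in> U \<and> U \<subseteq> K"
    using U by (meson compactin_subtopology openin_trans_full)
qed

section \<open>Minimal flows\<close>

text \<open>The group law makes the time \<open>- t\<close> map a continuous inverse.\<close>

lemma flow_on_homeomorphic_map:
  assumes "flow_on X f"
  shows "homeomorphic_map X X (\<lambda>x. f (t, x))"
proof -
  have cont: "continuous_map X X (\<lambda>x. f (s, x))" for s
  proof -
    have "continuous_map X (prod_topology euclideanreal X) (\<lambda>x. (s, x))"
      by (simp add: continuous_map_pairedI)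
    then show ?thesis
      using assms continuous_map_compose[of X _ "\<lambda>x. (s, x)" X f]
      by (simp add: flow_on_def o_def)
  qed
  have inv: "f (s, f (- s, x)) = x" if "x \<in> topspace X" for s x
  proof -
    have "f (s + - s, x) = f (s, f (- s, x))"
      using assms that unfolding flow_on_def by blast
    then show ?thesis
      using assms that by (simp add: flow_on_def)
  qed
  have "homeomorphic_maps X X (\<lambda>x. f (t, x)) (\<lambda>x. f (- t, x))"
    unfolding homeomorphic_maps_def using cont inv[of _ t] inv[of _ "- t"] by simp
  then show ?thesis
    by (auto simp: homeomorphic_map_maps)
qed

lemma minimal_flow_on_rational_time:
  assumes "minimal_flow_on X f" "openin X U" "U \<noteq> {}" "x \<in> topspace X"
  shows "\<exists>q\<in>\<rat>. f (q, x) \<in> U"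
proof -
  have flow: "flow_on X f" and dense: "X closure_of (f ` (UNIV \<times> {x})) = topspace X"
    using assms by (auto simp: minimal_flow_on_def)
  obtain u where "u \<in> U" "u \<in> topspace X"
    using assms(2,3) openin_subset by blast
  \<comment> \<open>One point of \<open>U\<close> in the closure of the orbit is enough for its
    neighbourhood \<open>U\<close> to meet the orbit.\<close>
  then have "u \<in> X closure_of (f ` (UNIV \<times> {x}))"
    by (simp add: dense)
  then have "\<exists>y \<in> f ` (UNIV \<times> {x}). y \<in> U"
    using assms(2) \<open>u \<in> U\<close> unfolding in_closure_of by blast
  then obtain t where t: "f (t, x) \<in> U"
    by blast
  have "continuous_map euclideanreal (prod_topology euclideanreal X) (\<lambda>t. (t, x))"
    using assms(4) by (simp add: continuous_map_pairedI)
  then have "continuous_map euclideanreal X (\<lambda>t. f (t, x))"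
    using flow continuous_map_compose[of euclideanreal _ "\<lambda>t. (t, x)" X f]
    by (simp add: flow_on_def o_def)
  \<comment> \<open>The visiting times form an open set, nonempty because of \<open>t\<close>, so
    the dense rationals meet it.\<close>
  then have "open {t. f (t, x) \<in> U}"
    using openin_continuous_map_preimage[OF _ assms(2)] by fastforce
  moreover have "closure \<rat> = (UNIV :: real set)"
    by (rule Rats_closure_real)
  ultimately have "{t. f (t, x) \<in> U} \<inter> \<rat> \<noteq> {}"
    using t open_Int_closure_eq_empty by blast
  then show ?thesis
    by blast
qed

lemma minimal_flow_on_second_countable:
  assumes min: "minimal_flow_on X f"
    and U: "openin X U" "U \<noteq> {}" "second_countable (subtopology X U)"
  shows "second_countable X"
proof -
  have flow: "flow_on X f"
    using min by (simp add: minimal_flow_on_def)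
  define W where "W t = {x \<in> topspace X. f (t, x) \<in> U}" for t
  have opW: "openin X (W t)" for t
    unfolding W_def
    using openin_continuous_map_preimage[OF homeomorphic_imp_continuous_map U(1)]
      flow_on_homeomorphic_map[OF flow] by blast
  have scW: "second_countable (subtopology X (W t))" for t
  proof -
    \<comment> \<open>\<open>W t\<close> is the full preimage of \<open>U\<close>, so the time
      \<open>t\<close> homeomorphism restricts to one from \<open>W t\<close> onto
      \<open>U\<close>.\<close>
    have "homeomorphic_map (subtopology X (W t)) (subtopology X U) (\<lambda>x. f (t, x))"
      by (rule homeomorphic_map_subtopologies_alt[OF flow_on_homeomorphic_map[OF flow]])
         (simp add: W_def)
    then show ?thesis
      using U(3) homeomorphic_map_imp_homeomorphic_space homeomorphic_space_second_countability
      by blast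
  qed
  have "topspace X \<subseteq> \<Union>(W ` \<rat>)"
    using minimal_flow_on_rational_time[OF min U(1,2)] by (auto simp: W_def)
  moreover have "countable (W ` \<rat>)"
    by (rule countable_image[OF countable_rat])
  moreover have "openin X V \<and> second_countable (subtopology X V)" if "V \<in> W ` \<rat>" for V
    using that opW scW by (elim imageE) simp
  ultimately show ?thesis
    using second_countable_countable_open_cover[of "W ` \<rat>" X] by simp
qed

theorem proposition3p2:
  fixes M :: "'a topology"
  assumes "manifold M"
    and "\<exists>f. minimal_flow_on M f"
  shows "metrizable_space M"
proof (cases "topspace M = {}")
  \<comment> \<open>Without a point there is no chart to start from, so the empty space is treated
    directly.\<close>
  case True
  then show ?thesis
    by (metis empty_metrizable_space null_topspace_iff_trivial)
next
  case False
  then obtain x where x: "x \<in> topspace M" by blast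
  obtain n where haus: "Hausdorff_space M" and loc: "locally_Euclidean n M"
    using assms(1) by (auto simp: manifold_def)
  obtain f where f: "minimal_flow_on M f"
    using assms(2) by blast
  obtain U V where U: "openin M U" "x \<in> U"
    and "subtopology M U homeomorphic_space subtopology (Euclidean_space n) V"
    using loc x unfolding locally_Euclidean_def by meson
  then have "second_countable (subtopology M U)"
    using homeomorphic_space_second_countability second_countable_Euclidean_space
      second_countable_subtopology by blast
  then have "second_countable M"
    using minimal_flow_on_second_countable[OF f U(1)] U(2) by blast
  moreover have "regular_space M"
    using locally_compact_Hausdorff_imp_regular_space
      locally_Euclidean_imp_locally_compact_space[OF loc] haus by blast
  ultimately show ?thesis
    using haus by (intro Urysohn_metrization)
qed

end
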